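(* Let $G=(V,E,w)$ be a connected graph and let $\pi\in\mathscr{P}_\star(V)$ be the stationary distribution of the simple random walk on $V$. Let $\mu\in\mathscr{P}_\star(V)$ be a fixed reference measure, and define edge weights $w^{(\mu)}=(w^{(\mu)}_{xy})_{\{x,y\}\in E}$ by $$w^{(\mu)}_{xy} := w_{xy}\,\theta\left(\frac{\mu(x)}{\pi(x)},\frac{\mu(y)}{\pi(y)}\right),\quad \{x,y\}\in E,$$ with associated Laplacian matrix $L_{w^{(\mu)}}$. Let $h\in\mathbb{R}^V_0$ be fixed with $\|h\|_2\le 1$. Then there exist constants $C,C'>0$, depending only on $G$ and $\mu$, such that for all $\varepsilon\in\mathbb{R}$ with $|\varepsilon|$ sufficiently small (depending only on $G$ and $\mu$), $$\frac{\varepsilon^2}{1+C'|\varepsilon|}\,h^\top L_{w^{(\mu)}}^\dagger h\ \le\ \mathcal{M}(\mu,\mu+\varepsilon h)^2\ \le\ \frac{\varepsilon^2}{1-C|\varepsilon|}\,h^\top L_{w^{(\mu)}}^\dagger h.$$ In particular, $\mathcal{M}(\mu,\mu+\varepsilon h)^2=|\varepsilon|^2\,h^\top L_{w^{(\mu)}}^\dagger h+o(|\varepsilon|^2)$ as $\varepsilon\to0$.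
   Context: A graph $G=(V,E,w)$ consists of a finite vertex set $V$, a set $E$ of $m\ge 1$ undirected edges (unordered pairs of distinct vertices), and positive edge weights $w=(w_{xy})_{\{x,y\}\in E}$ (with $w_{xy}=w_{yx}$). Write $y\sim x$ if $\{x,y\}\in E$. The degree of $x$ is $\mathrm{d}_x=\sum_{y\sim x}w_{xy}$; $D_w$ is the diagonal degree matrix, $A_w$ the weighted adjacency matrix, and $L_w=D_w-A_w$ the Laplacian matrix; the same notation is used for any other positive edge weights on $E$. The simple random walk on $V$ is the Markov chain with transition matrix $P=D_w^{-1}A_w$; for connected $G$ its unique stationary distribution is $\pi(x)=\mathrm{d}_x/\sum_{z\in V}\mathrm{d}_z$. $\mathscr{P}(V)$ is the simplex of probability densities on $V$ (nonnegative vectors in $\mathbb{R}^V$ with entries summing to $1$), and $\mathscr{P}_\star(V)$ is its interior (everywhere positive densities). $\mathbb{R}^V_0=\{f\in\mathbb{R}^V:\sum_{x}f(x)=0\}$. $X^\dagger$ is the Moore--Penrose inverse of a matrix $X$. The logarithmic mean is $\theta(a,b)=\int_0^1 a^{1-\lambda}b^\lambda\,d\lambda$ for $a,b\ge0$. Discrete transportation distance: for $\mu,\nu\in\mathscr{P}_\star(V)$, $$\mathcal{M}(\mu,\nu)^2=\inf \int_0^1\sum_{\{x,y\}\in E}w_{xy}(\psi_t(x)-\psi_t(y))^2\,\theta\left(\frac{\rho_t(x)}{\pi(x)},\frac{\rho_t(y)}{\pi(y)}\right)dt,$$ where the infimum is over all $\mathcal{C}^1$ curves $(\rho_t)_{t\in[0,1]}$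 with values in $\mathscr{P}_\star(V)$ and all Borel measurable $(\psi_t)_{t\in[0,1]}$ with values in $\mathbb{R}^V$ such that $\rho_0=\mu$, $\rho_1=\nu$, and for all $x\in V$, $t\in[0,1]$, $$\frac{d}{dt}\rho_t(x)+\sum_{y\sim x}w_{xy}(\psi_t(y)-\psi_t(x))\,\theta\left(\frac{\rho_t(x)}{\pi(x)},\frac{\rho_t(y)}{\pi(y)}\right)=0.$$ *)

theory Defs
  imports "HOL-Analysis.Analysis" "HOL-Library.Landau_Symbols"
begin

section \<open>Weighted graphs\<close>

text \<open>The vertex set is the universe of a type of class finite; edges are two-element sets of
  vertices.  Weights are functions of two vertices, of which only the values on pairs
  \<open>x y\<close> with \<open>{x, y} \<in> E\<close> are ever used.\<close>

definition edge_weights :: "'v::finite set set \<Rightarrow> ('v \<Rightarrow> 'v \<Rightarrow> real) \<Rightarrow> bool" where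
  "edge_weights E w \<longleftrightarrow> (\<forall>x y. {x, y} \<in> E \<longrightarrow> 0 < w x y \<and> w x y = w y x)"

definition weighted_graph :: "'v::finite set set \<Rightarrow> ('v \<Rightarrow> 'v \<Rightarrow> real) \<Rightarrow> bool" where
  "weighted_graph E w \<longleftrightarrow> E \<noteq> {} \<and> (\<forall>e\<in>E. card e = 2) \<and> edge_weights E w"

definition connected_graph :: "'v::finite set set \<Rightarrow> bool" where
  "connected_graph E \<longleftrightarrow> (\<forall>x y. (x, y) \<in> {(a, b). {a, b} \<in> E}\<^sup>*)"

definition degree :: "'v::finite set set \<Rightarrow> ('v \<Rightarrow> 'v \<Rightarrow> real) \<Rightarrow> 'v \<Rightarrow> real" where
  "degree E w x = (\<Sum>y | {x, y} \<in> E. w x y)"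

definition degree_matrix :: "'v::finite set set \<Rightarrow> ('v \<Rightarrow> 'v \<Rightarrow> real) \<Rightarrow> real^'v^'v" where
  "degree_matrix E w = (\<chi> x y. if x = y then degree E w x else 0)"

definition adjacency_matrix :: "'v::finite set set \<Rightarrow> ('v \<Rightarrow> 'v \<Rightarrow> real) \<Rightarrow> real^'v^'v" where
  "adjacency_matrix E w = (\<chi> x y. if {x, y} \<in> E then w x y else 0)"

definition laplacian :: "'v::finite set set \<Rightarrow> ('v \<Rightarrow> 'v \<Rightarrow> real) \<Rightarrow> real^'v^'v" where
  "laplacian E w = degree_matrix E w - adjacency_matrix E w"

definition transition_matrix :: "'v::finite set set \<Rightarrow> ('v \<Rightarrow> 'v \<Rightarrow> real) \<Rightarrow> real^'v^'v" where
  "transition_matrix E w = matrix_inv (degree_matrix E w) ** adjacency_matrix E w"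


section \<open>Probability densities\<close>

definition prob_densities :: "(real^'v::finite) set" where
  "prob_densities = {p. (\<forall>x. 0 \<le> p $ x) \<and> (\<Sum>x\<in>UNIV. p $ x) = 1}"

definition pos_prob_densities :: "(real^'v::finite) set" where
  "pos_prob_densities = {p. (\<forall>x. 0 < p $ x) \<and> (\<Sum>x\<in>UNIV. p $ x) = 1}"

definition sum_zero_vectors :: "(real^'v::finite) set" where
  "sum_zero_vectors = {f. (\<Sum>x\<in>UNIV. f $ x) = 0}"

definition stationary_distribution ::
    "'v::finite set set \<Rightarrow> ('v \<Rightarrow> 'v \<Rightarrow> real) \<Rightarrow> real^'v \<Rightarrow> bool" where
  "stationary_distribution E w p \<longleftrightarrow>
     p \<in> prob_densities \<and> p v* transition_matrix E w = p"


section \<open>Moore--Penrose inverse\<close>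

definition is_pinv :: "real^'n^'m \<Rightarrow> real^'m^'n \<Rightarrow> bool" where
  "is_pinv X Y \<longleftrightarrow>
     X ** Y ** X = X \<and> Y ** X ** Y = Y \<and>
     transpose (X ** Y) = X ** Y \<and> transpose (Y ** X) = Y ** X"

definition pinv :: "real^'n^'m \<Rightarrow> real^'m^'n" where
  "pinv X = (THE Y. is_pinv X Y)"

lemma is_pinv_unique:
  assumes "is_pinv X Y" "is_pinv X Z"
  shows "Y = Z"
proof -
  have XY: "X ** Y ** X = X" "Y ** X ** Y = Y" "transpose (X ** Y) = X ** Y"
      "transpose (Y ** X) = Y ** X"
    and XZ: "X ** Z ** X = X" "Z ** X ** Z = Z" "transpose (X ** Z) = X ** Z"
      "transpose (Z ** X) = Z ** X"
    using assms by (auto simp: is_pinv_def)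
  have "X ** Y = (X ** Z) ** (X ** Y)"
    by (metis XZ(1) matrix_mul_assoc)
  also have "\<dots> = transpose ((X ** Y) ** (X ** Z))"
    by (metis matrix_transpose_mul XY(3) XZ(3))
  also have "\<dots> = X ** Z"
    by (metis XY(1) XZ(3) matrix_mul_assoc)
  finally have l: "X ** Y = X ** Z" .
  have "Y ** X = (Y ** X) ** (Z ** X)"
    by (metis XZ(1) matrix_mul_assoc)
  also have "\<dots> = transpose ((Z ** X) ** (Y ** X))"
    by (metis matrix_transpose_mul XY(4) XZ(4))
  also have "\<dots> = Z ** X"
    by (metis XY(1) XZ(4) matrix_mul_assoc)
  finally have r: "Y ** X = Z ** X" .
  show ?thesis
    by (metis XY(2) XZ(2) l r matrix_mul_assoc)
qed


section \<open>Discrete transportation distance\<close>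

definition log_mean :: "real \<Rightarrow> real \<Rightarrow> real" where
  "log_mean a b = integral {0..1} (\<lambda>t. a powr (1 - t) * b powr t)"

definition edge_mean :: "real^'v::finite \<Rightarrow> real^'v \<Rightarrow> 'v \<Rightarrow> 'v \<Rightarrow> real" where
  "edge_mean \<pi> \<rho> x y = log_mean (\<rho> $ x / \<pi> $ x) (\<rho> $ y / \<pi> $ y)"

definition reweight ::
    "('v \<Rightarrow> 'v \<Rightarrow> real) \<Rightarrow> real^'v::finite \<Rightarrow> real^'v \<Rightarrow> 'v \<Rightarrow> 'v \<Rightarrow> real" where
  "reweight w \<pi> \<mu> x y = w x y * edge_mean \<pi> \<mu> x y"

text \<open>The summand is symmetric in \<open>x\<close> and \<open>y\<close>; the factor 1/2 turns the sum over ordered pairs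
  into the sum over unordered edges.\<close>

definition dirichlet_energy ::
    "'v::finite set set \<Rightarrow> ('v \<Rightarrow> 'v \<Rightarrow> real) \<Rightarrow> real^'v \<Rightarrow> real^'v \<Rightarrow> real^'v \<Rightarrow> real" where
  "dirichlet_energy E w \<pi> \<rho> \<psi> =
     (\<Sum>(x, y) | {x, y} \<in> E. w x y * (\<psi> $ x - \<psi> $ y)\<^sup>2 * edge_mean \<pi> \<rho> x y) / 2"

definition admissible ::
    "'v::finite set set \<Rightarrow> ('v \<Rightarrow> 'v \<Rightarrow> real) \<Rightarrow> real^'v \<Rightarrow> real^'v \<Rightarrow> real^'v \<Rightarrow>
     (real \<Rightarrow> real^'v) \<Rightarrow> (real \<Rightarrow> real^'v) \<Rightarrow> bool" where
  "admissible E w \<pi> \<mu> \<nu> \<rho> \<psi> \<longleftrightarrow>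
     (\<forall>t\<in>{0..1}. \<rho> t \<in> pos_prob_densities) \<and> \<rho> 0 = \<mu> \<and> \<rho> 1 = \<nu> \<and>
     \<psi> \<in> borel_measurable (restrict_space borel {0..1}) \<and>
     (\<exists>\<rho>'. continuous_on {0..1} \<rho>' \<and>
        (\<forall>t\<in>{0..1}. (\<rho> has_vector_derivative \<rho>' t) (at t within {0..1}) \<and>
          (\<forall>x. \<rho>' t $ x
             + (\<Sum>y | {x, y} \<in> E. w x y * (\<psi> t $ y - \<psi> t $ x) * edge_mean \<pi> (\<rho> t) x y) = 0)))"

definition action ::
    "'v::finite set set \<Rightarrow> ('v \<Rightarrow> 'v \<Rightarrow> real) \<Rightarrow> real^'v \<Rightarrow>
     (real \<Rightarrow> real^'v) \<Rightarrow> (real \<Rightarrow> real^'v) \<Rightarrow> ennreal" where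
  "action E w \<pi> \<rho> \<psi> =
     (\<integral>\<^sup>+ t\<in>{0..1}. ennreal (dirichlet_energy E w \<pi> (\<rho> t) (\<psi> t)) \<partial>lborel)"

text \<open>On a connected graph any two positive densities are joined by an admissible curve of finite
  action, so the infimum below is finite there and the conversion to a real number is harmless.\<close>

definition transport_dist ::
    "'v::finite set set \<Rightarrow> ('v \<Rightarrow> 'v \<Rightarrow> real) \<Rightarrow> real^'v \<Rightarrow> real^'v \<Rightarrow> real^'v \<Rightarrow> real" where
  "transport_dist E w \<pi> \<mu> \<nu> =
     sqrt (enn2real (INF (\<rho>, \<psi>) \<in> {(\<rho>, \<psi>). admissible E w \<pi> \<mu> \<nu> \<rho> \<psi>}. action E w \<pi> \<rho> \<psi>))"

end

theory Submission
  imports Defs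
begin

text \<open>
  Write \<open>L \<rho>\<close> for the Laplacian with the weights \<open>w\<close> reweighted by \<open>\<rho>\<close>.  The continuity equation reads
  \<open>L \<rho> \<psi> = \<rho>'\<close>, the energy is the quadratic form \<open>\<psi> \<bullet> L \<rho> \<psi>\<close>, and the energy required to
  produce a given \<open>\<rho>'\<close> is bounded below by \<open>2 (f \<bullet> \<rho>') - f \<bullet> L \<rho> f\<close> for every test function \<open>f\<close>.
  As the logarithmic mean is monotone and homogeneous, \<open>\<rho> \<le> c \<mu>\<close> gives \<open>L \<rho> \<le> c L \<mu>\<close> as quadratic
  forms.

  The upper bound comes from the straight line \<open>\<mu> + t \<epsilon> h\<close>, on which \<open>\<rho> \<ge> (1 - C \<bar>\<epsilon>\<bar>) \<mu>\<close>.  For the lower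
  bound, a curve of action \<open>O(\<epsilon>\<^sup>2)\<close> stays within \<open>O(\<bar>\<epsilon>\<bar>)\<close> of \<open>\<mu>\<close>, by the dual estimate
  with \<open>f\<close> a multiple of a coordinate vector, because the forms \<open>L \<rho>\<close> are bounded uniformly over
  all densities.  Hence \<open>\<rho> \<le> (1 + C' \<bar>\<epsilon>\<bar>) \<mu>\<close> along the curve, and the dual estimate with \<open>f\<close> a
  multiple of the potential \<open>\<phi>\<close> solving \<open>L \<mu> \<phi> = h\<close> gives the claim.
\<close>

section \<open>The logarithmic mean\<close>

lemma log_mean_integrand_continuous:
  assumes "0 < a" "0 < b"
  shows "continuous_on S (\<lambda>t::real. a powr (1 - t) * b powr t)"
  using assms by (intro continuous_intros) auto

lemma log_mean_integrable:
  assumes "0 < a" "0 < b"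
  shows "(\<lambda>t::real. a powr (1 - t) * b powr t) integrable_on {0..1}"
  by (intro integrable_continuous_real log_mean_integrand_continuous assms)

lemma log_mean_mono:
  assumes "0 < a" "0 < b" "a \<le> a'" "b \<le> b'"
  shows "log_mean a b \<le> log_mean a' b'"
  unfolding log_mean_def
  using assms by (intro integral_le log_mean_integrable mult_mono powr_mono2) auto

lemma log_mean_scale:
  assumes "0 < c" "0 < a" "0 < b"
  shows "log_mean (c * a) (c * b) = c * log_mean a b"
proof -
  have "(c * a) powr (1 - t) * (c * b) powr t = c * (a powr (1 - t) * b powr t)" for t
  proof -
    have "(c * a) powr (1 - t) * (c * b) powr t
        = (c powr (1 - t) * c powr t) * (a powr (1 - t) * b powr t)"
      using assms by (simp add: powr_mult)
    also have "c powr (1 - t) * c powr t = c"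
      using assms by (simp flip: powr_add)
    finally show ?thesis .
  qed
  then show ?thesis
    by (simp add: log_mean_def)
qed

lemma log_mean_self: "0 < a \<Longrightarrow> log_mean a a = a"
  by (simp add: log_mean_def flip: powr_add)

text \<open>Monotonicity, compared with the mean of two equal arguments, which is their common
  value. The upper bound by the maximum works the same way.\<close>

lemma log_mean_ge_min:
  assumes "0 < a" "0 < b"
  shows "min a b \<le> log_mean a b"
  using log_mean_mono[of "min a b" "min a b" a b] assms by (simp add: log_mean_self)

lemma log_mean_le_max:
  assumes "0 < a" "0 < b"
  shows "log_mean a b \<le> max a b"
  using log_mean_mono[of a b "max a b" "max a b"] assms by (simp add: log_mean_self)

lemma log_mean_pos:
  assumes "0 < a" "0 < b"
  shows "0 < log_mean a b"
  using log_mean_ge_min[OF assms] assms by linarith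

text \<open>Substituting \<open>1 - t\<close> for \<open>t\<close> swaps the two powers; the
  substitution is carried out as a unit shift followed by a reflection.\<close>

lemma log_mean_commute:
  "log_mean a b = log_mean b a"
proof -
  let ?f = "\<lambda>t::real. a powr (1 - t) * b powr t"
  have "log_mean b a = integral {0..1} (\<lambda>t. ?f (- t + 1))"
    by (simp add: log_mean_def mult.commute)
  also have "\<dots> = integral {0 - 1..1 - 1} (\<lambda>t. ?f (- (t + 1) + 1))"
    by (subst integral_shift_real_ivl) simp
  also have "\<dots> = integral {- 1..- 0} (\<lambda>t. ?f (- t))"
    by simp
  also have "\<dots> = log_mean a b"
    unfolding log_mean_def by (rule Henstock_Kurzweil_Integration.integral_reflect_real)
  finally show ?thesis ..
qed

text \<open>The integrand is jointly continuous in the parameter and the integration variable, and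
  the interval is compact. This makes the reweighted edge weights continuous in time along a curve
  of positive densities.\<close>

lemma continuous_on_log_mean:
  assumes "continuous_on S a" "continuous_on S b"
    and "\<And>s. s \<in> S \<Longrightarrow> 0 < a s" "\<And>s. s \<in> S \<Longrightarrow> 0 < b s"
  shows "continuous_on S (\<lambda>s. log_mean (a s) (b s))"
proof -
  have "continuous_on (S \<times> cbox 0 1) (\<lambda>(s, t). a s powr (1 - t) * b s powr t)"
    unfolding case_prod_beta
    by (intro continuous_intros continuous_on_compose2[OF assms(1)] continuous_on_compose2[OF assms(2)])
       (use assms(3,4) in force)+
  from integral_continuous_on_param[OF this] show ?thesis
    by (simp add: log_mean_def)
qed

section \<open>Weighted Laplacians\<close>

lemma connected_graph_induct:
  assumes "connected_graph E" "P x" "\<And>a b. P a \<Longrightarrow> {a, b} \<in> E \<Longrightarrow> P b"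
  shows "P y"
proof -
  have "(x, y) \<in> {(a, b). {a, b} \<in> E}\<^sup>*"
    using assms(1) by (simp add: connected_graph_def)
  then show ?thesis
    by induction (use assms in auto)
qed

lemma laplacian_mult_nth:
  assumes "\<forall>e\<in>E. card e = 2"
  shows "(laplacian E k *v f) $ x = (\<Sum>y | {x, y} \<in> E. k x y * (f $ x - f $ y))"
proof -
  have "(degree_matrix E k *v f) $ x = degree E k x * f $ x"
    by (simp add: matrix_vector_mult_def degree_matrix_def if_distrib[of "\<lambda>z. z * _"] cong: if_cong)
  moreover have "(adjacency_matrix E k *v f) $ x = (\<Sum>y | {x, y} \<in> E. k x y * f $ y)"
    by (simp add: matrix_vector_mult_def adjacency_matrix_def if_distrib[of "\<lambda>z. z * _"] sum.If_cases
        cong: if_cong)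
  ultimately show ?thesis
    by (simp add: laplacian_def matrix_vector_mult_diff_rdistrib degree_def
        sum_distrib_right sum_subtractf right_diff_distrib)
qed

section \<open>The quadratic form of a weighted Laplacian\<close>

lemma sum_edges_swap:
  "(\<Sum>(x, y) | {x, y} \<in> E. g x y) = (\<Sum>(x, y) | {x, y} \<in> E. g y x)"
  by (rule sum.reindex_bij_witness[of _ "\<lambda>(x, y). (y, x)" "\<lambda>(x, y). (y, x)"])
     (auto simp: insert_commute)

lemma sum_edges_Sigma:
  fixes E :: "'v::finite set set"
  shows "(\<Sum>x\<in>UNIV. \<Sum>y | {x, y} \<in> E. g x y) = (\<Sum>(x, y) | {x, y} \<in> E. g x y)"
  by (subst sum.Sigma) (auto intro!: sum.cong)

text \<open>Summation by parts: the sum over ordered pairs is averaged with its copy in which the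
  two vertices are exchanged.\<close>

lemma inner_laplacian:
  assumes "\<forall>e\<in>E. card e = 2" and k: "edge_weights E k"
  shows "g \<bullet> (laplacian E k *v f)
    = (\<Sum>(x, y) | {x, y} \<in> E. k x y * (f $ x - f $ y) * (g $ x - g $ y)) / 2"
proof -
  let ?s = "\<Sum>(x, y) | {x, y} \<in> E. g $ x * k x y * (f $ x - f $ y)"
  have 1: "g \<bullet> (laplacian E k *v f) = ?s"
    by (simp add: inner_vec_def laplacian_mult_nth[OF assms(1)] sum_distrib_left mult.assoc
        flip: sum_edges_Sigma)
  have "?s = (\<Sum>(x, y) | {x, y} \<in> E. g $ y * k y x * (f $ y - f $ x))"
    by (rule sum_edges_swap)
  also have "\<dots> = (\<Sum>(x, y) | {x, y} \<in> E. g $ y * k x y * (f $ y - f $ x))"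
    using k by (intro sum.cong) (auto simp: edge_weights_def, metis)
  finally have "2 * ?s = (\<Sum>(x, y) | {x, y} \<in> E. g $ x * k x y * (f $ x - f $ y))
      + (\<Sum>(x, y) | {x, y} \<in> E. g $ y * k x y * (f $ y - f $ x))"
    by simp
  also have "\<dots> = (\<Sum>(x, y) | {x, y} \<in> E. k x y * (f $ x - f $ y) * (g $ x - g $ y))"
    by (subst sum.distrib[symmetric]) (auto intro!: sum.cong simp: algebra_simps)
  finally show ?thesis
    using 1 by simp
qed

lemma inner_laplacian_commute:
  assumes "\<forall>e\<in>E. card e = 2" "edge_weights E k"
  shows "g \<bullet> (laplacian E k *v f) = f \<bullet> (laplacian E k *v g)"
  unfolding inner_laplacian[OF assms] by (simp add: mult_ac)

lemma laplacian_form_nonneg: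
  assumes "\<forall>e\<in>E. card e = 2" "edge_weights E k"
  shows "0 \<le> f \<bullet> (laplacian E k *v f)"
  unfolding inner_laplacian[OF assms] using assms(2)
  by (auto intro!: sum_nonneg divide_nonneg_nonneg simp: edge_weights_def mult.assoc less_imp_le)

lemma laplacian_form_mono:
  assumes "\<forall>e\<in>E. card e = 2" "edge_weights E k" "edge_weights E k'"
    and le: "\<And>x y. {x, y} \<in> E \<Longrightarrow> k x y \<le> c * k' x y"
  shows "f \<bullet> (laplacian E k *v f) \<le> c * (f \<bullet> (laplacian E k' *v f))"
proof -
  have "k x y * (f $ x - f $ y) * (f $ x - f $ y) \<le> c * (k' x y * (f $ x - f $ y) * (f $ x - f $ y))"
    if "{x, y} \<in> E" for x y
    using mult_right_mono[OF le[OF that], of "(f $ x - f $ y) * (f $ x - f $ y)"]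
    by (simp add: mult.assoc)
  then show ?thesis
    unfolding inner_laplacian[OF assms(1,2)] inner_laplacian[OF assms(1,3)]
    by (auto simp: sum_distrib_left intro!: divide_right_mono sum_mono)
qed

text \<open>Expand the nonnegative form at \<open>g - f\<close>; equality holds for
  \<open>f = g\<close>. The left side sees \<open>g\<close> only through
  \<open>laplacian E k *v g\<close>, so the energy of the potential of a curve is bounded below in
  terms of the velocity of the curve.\<close>

lemma laplacian_duality:
  assumes "\<forall>e\<in>E. card e = 2" "edge_weights E k"
  shows "2 * (f \<bullet> (laplacian E k *v g)) - f \<bullet> (laplacian E k *v f) \<le> g \<bullet> (laplacian E k *v g)"
  using laplacian_form_nonneg[OF assms, of "g - f"] inner_laplacian_commute[OF assms, of f g]
  by (simp add: matrix_vector_mult_diff_distrib inner_diff_left inner_diff_right)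

text \<open>On a connected graph the Laplacian has the constants as its kernel; adding the projection onto
  the constants makes it invertible.\<close>

definition mean_matrix :: "real^'v^'v::finite" where
  "mean_matrix = (\<chi> x y. 1 / real CARD('v))"

lemma mean_matrix_mult_nth:
  "(mean_matrix *v f) $ x = (\<Sum>y\<in>UNIV. f $ y) / real CARD('v)" for f :: "real^'v::finite"
  by (simp add: mean_matrix_def matrix_vector_mult_def sum_divide_distrib)

lemma mean_matrix_mult_sum_zero: "f \<in> sum_zero_vectors \<Longrightarrow> mean_matrix *v f = 0"
  by (simp add: vec_eq_iff mean_matrix_mult_nth sum_zero_vectors_def)

lemma sum_laplacian:
  assumes "\<forall>e\<in>E. card e = 2" "edge_weights E k"
  shows "(\<Sum>x\<in>UNIV. (laplacian E k *v f) $ x) = 0"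
  using inner_laplacian[OF assms, of 1 f] by (simp add: inner_vec_def)

text \<open>Summing the coordinates removes the Laplacian and shows that \<open>f\<close> has sum
  zero, so the projection vanishes as well. Then the form of \<open>f\<close> is zero,
  \<open>f\<close> agrees across each edge, and connectedness makes it constant, hence zero.\<close>

lemma laplacian_plus_mean_ker:
  assumes "\<forall>e\<in>E. card e = 2" "edge_weights E k" "connected_graph E"
    and 0: "(laplacian E k + mean_matrix) *v f = 0"
  shows "f = 0"
proof -
  have "(\<Sum>x\<in>UNIV. ((laplacian E k + mean_matrix) *v f) $ x) = (\<Sum>x\<in>UNIV. f $ x)"
    by (simp add: matrix_vector_mult_add_rdistrib sum.distrib sum_laplacian[OF assms(1,2)]
        mean_matrix_mult_nth)
  then have f: "(\<Sum>x\<in>UNIV. f $ x) = 0"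
    using 0 by simp
  then have "laplacian E k *v f = 0"
    using 0 by (simp add: matrix_vector_mult_add_rdistrib mean_matrix_mult_sum_zero sum_zero_vectors_def)
  then have "(\<Sum>(x, y) | {x, y} \<in> E. k x y * (f $ x - f $ y) * (f $ x - f $ y)) = 0"
    using inner_laplacian[OF assms(1,2), of f f] by simp
  then have "\<forall>p\<in>{(x, y). {x, y} \<in> E}. (case p of (x, y) \<Rightarrow> k x y * (f $ x - f $ y) * (f $ x - f $ y)) = 0"
    using assms(2)
    by (subst (asm) sum_nonneg_eq_0_iff) (auto simp: edge_weights_def mult.assoc less_imp_le)
  then have edge: "f $ x = f $ y" if "{x, y} \<in> E" for x y
    using that assms(2) by (force simp: edge_weights_def)
  have const: "f $ y = f $ x" for x y
    by (rule connected_graph_induct[OF assms(3), of "\<lambda>y. f $ y = f $ x"]) (auto dest: edge)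
  have "f $ x = 0" for x
  proof -
    have "(\<Sum>y\<in>UNIV. f $ y) = real CARD('a) * f $ x"
      by (subst sum.cong[OF refl const[of _ x]]) auto
    then show ?thesis using f by simp
  qed
  then show ?thesis by (simp add: vec_eq_iff)
qed

lemma laplacian_plus_mean_invertible:
  assumes "\<forall>e\<in>E. card e = 2" "edge_weights E k" "connected_graph E"
  shows "invertible (laplacian E k + mean_matrix)"
  unfolding invertible_left_inverse matrix_left_invertible_ker
  using laplacian_plus_mean_ker[OF assms] by blast

text \<open>The sum \<open>laplacian E k + mean_matrix\<close> is the identity on constants and the
  Laplacian on sum-zero vectors, so subtracting \<open>mean_matrix\<close> from its inverse leaves
  an operator that kills constants and inverts the Laplacian on sum-zero vectors. Both products are
  then the symmetric projection \<open>mat 1 - mean_matrix\<close>, and the Penrose equations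
  follow.\<close>

lemma is_pinv_laplacian:
  fixes E :: "'v::finite set set"
  assumes "\<forall>e\<in>E. card e = 2" "edge_weights E k" "connected_graph E"
    and inv: "(laplacian E k + mean_matrix) ** M' = mat 1" "M' ** (laplacian E k + mean_matrix) = mat 1"
  shows "is_pinv (laplacian E k) (M' - mean_matrix)"
    and "laplacian E k ** (M' - mean_matrix) = mat 1 - mean_matrix"
proof -
  let ?L = "laplacian E k" and ?P = "mean_matrix :: real^'v^'v"
  have LP: "?L *v (?P *v f) = 0" for f
    by (simp add: vec_eq_iff laplacian_mult_nth[OF assms(1)] mean_matrix_mult_nth)
  have PL: "?P *v (?L *v f) = 0" for f
    by (simp add: vec_eq_iff sum_laplacian[OF assms(1,2)] mean_matrix_mult_nth)
  have PP: "?P *v (?P *v f) = ?P *v f" for f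
    by (simp add: vec_eq_iff mean_matrix_mult_nth)
  have MM': "?L *v (M' *v f) + ?P *v (M' *v f) = f" for f
    by (metis inv(1) matrix_vector_mul_assoc matrix_vector_mul_lid matrix_vector_mult_add_rdistrib)
  have M'M: "M' *v (?L *v f) + M' *v (?P *v f) = f" for f
    by (metis inv(2) matrix_vector_mul_assoc matrix_vector_mul_lid matrix_vector_mult_add_rdistrib
        matrix_vector_right_distrib)
  have M'P: "M' *v (?P *v f) = ?P *v f" for f
    using M'M[of "?P *v f"] by (simp add: LP PP)
  have PM': "?P *v (M' *v f) = ?P *v f" for f
  proof -
    have "?P *v f = ?P *v (?L *v (M' *v f) + ?P *v (M' *v f))"
      by (simp add: MM')
    then show ?thesis
      by (simp add: matrix_vector_right_distrib PL PP)
  qed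
  have LM': "?L *v (M' *v f) = f - ?P *v f" for f
    using MM'[of f] by (simp add: PM' algebra_simps)
  have M'L: "M' *v (?L *v f) = f - ?P *v f" for f
    using M'M[of f] by (simp add: M'P algebra_simps)
  note mult_simps = matrix_vector_mul_assoc[symmetric] matrix_vector_mult_diff_rdistrib
    matrix_vector_mult_diff_distrib
  show 1: "?L ** (M' - ?P) = mat 1 - ?P"
    by (simp add: matrix_eq mult_simps LM' LP)
  have 2: "(M' - ?P) ** ?L = mat 1 - ?P"
    by (simp add: matrix_eq mult_simps M'L PL)
  have 3: "(mat 1 - ?P) ** ?L = ?L" "(mat 1 - ?P) ** (M' - ?P) = M' - ?P"
    by (simp_all add: matrix_eq mult_simps PL PM' PP)
  have "transpose (mat 1 - ?P) = mat 1 - ?P"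
    by (simp add: vec_eq_iff transpose_def mat_def mean_matrix_def eq_commute)
  then show "is_pinv ?L (M' - ?P)"
    by (simp add: is_pinv_def 1 2 3)
qed

lemma pinv_eq: "is_pinv X Y \<Longrightarrow> pinv X = Y"
  unfolding pinv_def by (blast intro: is_pinv_unique the_equality)

lemma laplacian_pinv:
  assumes "\<forall>e\<in>E. card e = 2" "edge_weights E k" "connected_graph E" "h \<in> sum_zero_vectors"
  shows "laplacian E k *v (pinv (laplacian E k) *v h) = h"
proof -
  obtain M' where "(laplacian E k + mean_matrix) ** M' = mat 1"
      "M' ** (laplacian E k + mean_matrix) = mat 1"
    using laplacian_plus_mean_invertible[OF assms(1-3)] by (auto simp: invertible_def)
  note * = is_pinv_laplacian[OF assms(1-3) this]
  show ?thesis
    unfolding pinv_eq[OF *(1)] matrix_vector_mul_assoc *(2)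
    by (simp add: matrix_vector_mult_diff_rdistrib mean_matrix_mult_sum_zero[OF assms(4)])
qed

text \<open>Summing the coordinates shows that \<open>f\<close> has sum zero, so the projection
  drops out. The singular equation for a potential can therefore be replaced by an invertible
  one.\<close>

lemma laplacian_plus_mean_solution:
  assumes "\<forall>e\<in>E. card e = 2" "edge_weights E k" "h \<in> sum_zero_vectors"
    and f: "(laplacian E k + mean_matrix) *v f = h"
  shows "laplacian E k *v f = h"
proof -
  have "(\<Sum>x\<in>UNIV. f $ x) = (\<Sum>x\<in>UNIV. ((laplacian E k + mean_matrix) *v f) $ x)"
    by (simp add: matrix_vector_mult_add_rdistrib sum.distrib sum_laplacian[OF assms(1,2)]
        mean_matrix_mult_nth)
  then have "f \<in> sum_zero_vectors"
    using f assms(3) by (simp add: sum_zero_vectors_def)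
  then show ?thesis
    using f by (simp add: matrix_vector_mult_add_rdistrib mean_matrix_mult_sum_zero)
qed

text \<open>Cramer's rule writes each coordinate of the solution as a quotient of determinants,
  which are polynomials in the entries.\<close>

lemma continuous_on_linear_solve:
  fixes A :: "'t::topological_space \<Rightarrow> real^'n^'n"
  assumes "continuous_on S A" "\<And>t. t \<in> S \<Longrightarrow> invertible (A t)"
  obtains f where "continuous_on S f" "\<And>t. t \<in> S \<Longrightarrow> A t *v f t = b"
proof
  let ?f = "\<lambda>t. \<chi> k. det (\<chi> i j. if j = k then b $ i else A t $ i $ j) / det (A t)"
  have det: "continuous_on S (\<lambda>t. det (B t))"
    if "\<And>i j. continuous_on S (\<lambda>t. B t $ i $ j)" for B :: "'t \<Rightarrow> real^'n^'n"
    unfolding det_def by (intro continuous_intros that)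
  have "continuous_on S (\<lambda>t. if j = k then b $ i else A t $ i $ j)" for i j k
    by (cases "j = k") (auto intro!: continuous_intros assms(1))
  then show "continuous_on S ?f"
    using assms(2) by (intro continuous_intros det) (auto simp: invertible_det_nz intro!: continuous_intros assms(1))
  show "A t *v ?f t = b" if "t \<in> S" for t
    using cramer[of "A t" "?f t" b] assms(2)[OF that] by (simp add: invertible_det_nz)
qed

section \<open>Estimates of the action\<close>

text \<open>Some entry is positive because the entries sum to 1. Stationarity gives
  \<open>\<pi> $ b\<close> at least the mass that \<open>a\<close> sends to \<open>b\<close> in one
  step, so positivity spreads along edges to all vertices.\<close>

lemma stationary_distribution_pos:
  assumes E: "weighted_graph E w" and "connected_graph E" and "stationary_distribution E w \<pi>"
  shows "0 < \<pi> $ x"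
proof -
  have w: "0 < w x y" if "{x, y} \<in> E" for x y
    using E that by (auto simp: weighted_graph_def edge_weights_def)
  have \<pi>: "0 \<le> \<pi> $ x" "(\<Sum>x\<in>UNIV. \<pi> $ x) = 1" "\<pi> v* transition_matrix E w = \<pi>" for x
    using assms(3) by (auto simp: stationary_distribution_def prob_densities_def)
  obtain a b where ab: "{a, b} \<in> E"
    using E by (metis weighted_graph_def card_2_iff ex_in_conv)
  have "\<exists>y. {x, y} \<in> E" for x
    by (rule connected_graph_induct[OF assms(2), of "\<lambda>x. \<exists>y. {x, y} \<in> E" a])
       (use ab in \<open>auto, metis insert_commute\<close>)
  then have deg: "0 < degree E w x" for x
    unfolding degree_def using w by (intro sum_pos) auto
  let ?D = "degree_matrix E w" and ?D' = "\<chi> x y. if x = y then 1 / degree E w x else 0"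
  have diag: "((\<chi> x y. if x = y then d x else 0) ** (A :: real^'a^'a)) = (\<chi> x y. d x * A $ x $ y)"
    for d :: "'a \<Rightarrow> real" and A
    by (simp add: vec_eq_iff matrix_matrix_mult_def if_distrib[of "\<lambda>z. z * _"] cong: if_cong)
  have D: "?D ** ?D' = mat 1" "?D' ** ?D = mat 1"
    using deg[THEN less_imp_neq]
    by (auto simp: degree_matrix_def diag vec_eq_iff mat_def)
  \<comment> \<open>\<open>matrix_inv\<close> is a choice term: the explicit inverse
    \<open>?D'\<close> shows that the choice succeeds, and uniqueness of inverses then identifies
    the two.\<close>
  then have "?D ** matrix_inv ?D = mat 1 \<and> matrix_inv ?D ** ?D = mat 1"
    unfolding matrix_inv_def by (rule someI[of _ ?D', OF conjI])
  then have "?D' ** (?D ** matrix_inv ?D) = ?D'"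
    by simp
  then have "matrix_inv ?D = ?D'"
    by (simp add: matrix_mul_assoc D(2))
  then have P: "transition_matrix E w $ x $ y = (if {x, y} \<in> E then w x y / degree E w x else 0)" for x y
    by (simp add: transition_matrix_def diag adjacency_matrix_def)
  have P_nonneg: "0 \<le> transition_matrix E w $ x $ y" for x y
    using deg[of x] w[of x y] by (auto simp: P)
  obtain z where z: "0 < \<pi> $ z"
  proof -
    have "\<exists>z. 0 < \<pi> $ z"
    proof (rule ccontr)
      assume "\<nexists>z. 0 < \<pi> $ z"
      then have "\<pi> $ x = 0" for x
        using \<pi>(1)[of x] by (metis less_eq_real_def)
      then show False using \<pi>(2) by simp
    qed
    then show ?thesis using that by blast
  qed
  show ?thesis
  proof (rule connected_graph_induct[OF assms(2), of "\<lambda>x. 0 < \<pi> $ x", OF z])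
    fix a b
    assume a: "0 < \<pi> $ a" and ab: "{a, b} \<in> E"
    have "0 < transition_matrix E w $ a $ b * \<pi> $ a"
      using a deg[of a] w[OF ab] ab by (simp add: P)
    also have "\<dots> \<le> (\<Sum>x\<in>UNIV. transition_matrix E w $ x $ b * \<pi> $ x)"
      using P_nonneg \<pi>(1) by (intro member_le_sum) auto
    also have "\<dots> = (\<pi> v* transition_matrix E w) $ b"
      by (simp add: vector_matrix_mult_def mult.commute)
    finally show "0 < \<pi> $ b"
      by (simp add: \<pi>(3))
  qed
qed

section \<open>Energies of densities and the dual bound on the action\<close>

locale transport_graph =
  fixes E :: "'v::finite set set" and w :: "'v \<Rightarrow> 'v \<Rightarrow> real" and \<pi> :: "real^'v"
  assumes graph: "weighted_graph E w" and connected: "connected_graph E"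
    and \<pi>_pos: "\<And>x. 0 < \<pi> $ x"
begin

abbreviation L :: "real^'v \<Rightarrow> real^'v^'v" where
  "L \<rho> \<equiv> laplacian E (reweight w \<pi> \<rho>)"

lemma edges: "\<forall>e\<in>E. card e = 2" and edge_weights: "edge_weights E w"
  using graph by (auto simp: weighted_graph_def)

lemma edge_weights_reweight:
  assumes "\<And>x. 0 < \<rho> $ x"
  shows "edge_weights E (reweight w \<pi> \<rho>)"
  using edge_weights assms \<pi>_pos
  by (auto simp: edge_weights_def reweight_def edge_mean_def log_mean_commute
      intro!: mult_pos_pos log_mean_pos)

lemma L_form_scale:
  assumes "\<And>x. 0 < \<rho> $ x" "\<And>x. 0 < \<mu> $ x" "0 < c" "\<And>x. \<rho> $ x \<le> c * \<mu> $ x"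
  shows "f \<bullet> (L \<rho> *v f) \<le> c * (f \<bullet> (L \<mu> *v f))"
proof (rule laplacian_form_mono[OF edges edge_weights_reweight edge_weights_reweight])
  fix x y
  assume "{x, y} \<in> E"
  then have w: "0 \<le> w x y"
    using edge_weights by (auto simp: edge_weights_def less_imp_le)
  have "\<rho> $ x / \<pi> $ x \<le> c * (\<mu> $ x / \<pi> $ x)" for x
    using assms(4)[of x] \<pi>_pos[of x] by (simp add: divide_right_mono)
  then have "edge_mean \<pi> \<rho> x y \<le> log_mean (c * (\<mu> $ x / \<pi> $ x)) (c * (\<mu> $ y / \<pi> $ y))"
    unfolding edge_mean_def using assms \<pi>_pos by (intro log_mean_mono) auto
  also have "\<dots> = c * edge_mean \<pi> \<mu> x y"
    unfolding edge_mean_def using assms \<pi>_pos by (intro log_mean_scale) auto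
  finally show "reweight w \<pi> \<rho> x y \<le> c * reweight w \<pi> \<mu> x y"
    by (auto dest: mult_left_mono[OF _ w] simp: reweight_def mult.left_commute)
qed (use assms in auto)

text \<open>Entries of a probability density are at most 1, so each ratio to \<open>\<pi>\<close>,
  and with it each edge mean, is at most \<open>1 / p\<close>. The bound does not depend on
  \<open>\<rho>\<close>, so it applies to a curve before its position is known.\<close>

lemma L_form_le:
  assumes "\<rho> \<in> pos_prob_densities" "0 < p" "\<And>x. p \<le> \<pi> $ x"
  shows "f \<bullet> (L \<rho> *v f) \<le> 1 / p * (f \<bullet> (laplacian E w *v f))"
proof (rule laplacian_form_mono[OF edges edge_weights_reweight edge_weights])
  have pos: "0 < \<rho> $ x" for x
    using assms(1) by (simp add: pos_prob_densities_def)
  then show "0 < \<rho> $ x" for x .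
  have "\<rho> $ x \<le> (\<Sum>x\<in>UNIV. \<rho> $ x)" for x
    using pos by (intro member_le_sum) (auto simp: less_imp_le)
  then have le: "\<rho> $ x \<le> 1" for x
    using assms(1) by (simp add: pos_prob_densities_def)
  have le: "\<rho> $ x / \<pi> $ x \<le> 1 / p" for x
    using assms(2,3) le pos by (intro frac_le) (auto simp: less_imp_le)
  fix x y
  assume "{x, y} \<in> E"
  then have w: "0 \<le> w x y"
    using edge_weights by (auto simp: edge_weights_def less_imp_le)
  have "edge_mean \<pi> \<rho> x y \<le> max (\<rho> $ x / \<pi> $ x) (\<rho> $ y / \<pi> $ y)"
    unfolding edge_mean_def using pos \<pi>_pos by (intro log_mean_le_max) auto
  also have "\<dots> \<le> 1 / p"
    using le by simp
  finally show "reweight w \<pi> \<rho> x y \<le> 1 / p * w x y"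
    using mult_left_mono[OF _ w] by (fastforce simp: reweight_def)
qed

lemma dirichlet_energy_eq:
  assumes "\<And>x. 0 < \<rho> $ x"
  shows "dirichlet_energy E w \<pi> \<rho> \<psi> = \<psi> \<bullet> (L \<rho> *v \<psi>)"
  unfolding inner_laplacian[OF edges edge_weights_reweight[OF assms]] dirichlet_energy_def
  by (simp add: reweight_def power2_eq_square mult_ac)

lemma continuity_equation_iff:
  "(\<forall>x. r $ x + (\<Sum>y | {x, y} \<in> E. w x y * (\<psi> $ y - \<psi> $ x) * edge_mean \<pi> \<rho> x y) = 0)
    \<longleftrightarrow> L \<rho> *v \<psi> = r"
proof -
  have "(\<Sum>y | {x, y} \<in> E. w x y * (\<psi> $ y - \<psi> $ x) * edge_mean \<pi> \<rho> x y) = - (L \<rho> *v \<psi>) $ x" for x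
    unfolding laplacian_mult_nth[OF edges] sum_negf[symmetric]
    by (intro sum.cong) (auto simp: reweight_def algebra_simps)
  then show ?thesis
    by (auto simp: vec_eq_iff)
qed

lemma admissible_iff:
  "admissible E w \<pi> \<mu> \<nu> \<rho> \<psi> \<longleftrightarrow>
     (\<forall>t\<in>{0..1}. \<rho> t \<in> pos_prob_densities) \<and> \<rho> 0 = \<mu> \<and> \<rho> 1 = \<nu> \<and>
     \<psi> \<in> borel_measurable (restrict_space borel {0..1}) \<and>
     (\<exists>\<rho>'. continuous_on {0..1} \<rho>' \<and>
        (\<forall>t\<in>{0..1}. (\<rho> has_vector_derivative \<rho>' t) (at t within {0..1}) \<and>
          L (\<rho> t) *v \<psi> t = \<rho>' t))"
  unfolding admissible_def continuity_equation_iff ..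

text \<open>Integrate \<open>laplacian_duality\<close> in time with \<open>f\<close> fixed: the
  velocity term becomes the displacement by the fundamental theorem of calculus, and the energy
  after time \<open>T\<close> is nonnegative. Intermediate \<open>T\<close> serves to locate the
  curve, \<open>T = 1\<close> to bound its action.\<close>

lemma action_ge:
  assumes adm: "admissible E w \<pi> \<mu> \<nu> \<rho> \<psi>" and T: "0 \<le> T" "T \<le> 1"
    and B: "\<And>t. t \<in> {0..T} \<Longrightarrow> f \<bullet> (L (\<rho> t) *v f) \<le> B"
  shows "ennreal (2 * (f \<bullet> (\<rho> T - \<mu>)) - B * T) \<le> action E w \<pi> \<rho> \<psi>"
proof -
  obtain \<rho>' where \<rho>: "\<And>t. t \<in> {0..1} \<Longrightarrow> \<rho> t \<in> pos_prob_densities" "\<rho> 0 = \<mu>"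
    and \<rho>': "continuous_on {0..1} \<rho>'"
      "\<And>t. t \<in> {0..1} \<Longrightarrow> (\<rho> has_vector_derivative \<rho>' t) (at t within {0..1})"
      "\<And>t. t \<in> {0..1} \<Longrightarrow> L (\<rho> t) *v \<psi> t = \<rho>' t"
    using adm unfolding admissible_iff by auto
  have pos: "0 < \<rho> t $ x" if "t \<in> {0..1}" for t x
    using \<rho>(1)[OF that] by (simp add: pos_prob_densities_def)
  define g where "g t = 2 * (f \<bullet> \<rho>' t) - B" for t
  have energy: "g t \<le> dirichlet_energy E w \<pi> (\<rho> t) (\<psi> t)" "0 \<le> dirichlet_energy E w \<pi> (\<rho> t) (\<psi> t)"
    if "t \<in> {0..T}" for t
  proof -
    have t: "t \<in> {0..1}"
      using that T by auto
    note w = edges edge_weights_reweight[OF pos[OF t]]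
    show "g t \<le> dirichlet_energy E w \<pi> (\<rho> t) (\<psi> t)" "0 \<le> dirichlet_energy E w \<pi> (\<rho> t) (\<psi> t)"
      using laplacian_duality[OF w, of f "\<psi> t"] laplacian_form_nonneg[OF w, of "\<psi> t"] B[OF that]
      by (simp_all add: g_def dirichlet_energy_eq[OF pos[OF t]] \<rho>'(3)[OF t])
  qed
  have "((\<lambda>t. 2 * (f \<bullet> \<rho> t) - B * t) has_vector_derivative g t) (at t within {0..T})"
    if "t \<in> {0..T}" for t
    unfolding g_def using T that
    by (auto intro!: derivative_eq_intros has_vector_derivative_within_subset[OF \<rho>'(2)]
        bounded_linear.has_vector_derivative[OF bounded_linear_inner_right]
        simp: has_vector_derivative_mult_right)
  from fundamental_theorem_of_calculus[OF T(1) this]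
  have g: "(g has_integral 2 * (f \<bullet> (\<rho> T - \<mu>)) - B * T) {0..T}"
    by (simp add: \<rho>(2) inner_diff_right algebra_simps)
  \<comment> \<open>The action is a nonnegative integral while \<open>g\<close> may be negative, so
    the comparison passes through the positive part of \<open>g\<close>.\<close>
  have "continuous_on {0..T} (\<lambda>t. max (g t) 0)"
    unfolding g_def using T
    by (intro continuous_intros continuous_on_subset[OF \<rho>'(1)]) auto
  then have max: "((\<lambda>t. max (g t) 0) has_integral integral {0..T} (\<lambda>t. max (g t) 0)) {0..T}"
    by (intro integrable_integral integrable_continuous_real)
  have "ennreal (2 * (f \<bullet> (\<rho> T - \<mu>)) - B * T) \<le> ennreal (integral {0..T} (\<lambda>t. max (g t) 0))"
    by (intro ennreal_leI has_integral_le[OF g max]) auto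
  also have "\<dots> = (\<integral>\<^sup>+ t. ennreal (max (g t) 0) * indicator {0..T} t \<partial>lborel)"
    by (rule nn_integral_has_integral_lebesgue'[OF _ max, symmetric]) auto
  also have "\<dots> \<le> action E w \<pi> \<rho> \<psi>"
    unfolding action_def using energy T
    by (intro nn_integral_mono) (auto simp: indicator_def intro!: ennreal_leI)
  finally show ?thesis .
qed

end

section \<open>Perturbations of the reference measure\<close>

text \<open>The number \<open>m\<close> turns an absolute displacement into one relative to
  \<open>\<mu>\<close>; it is later taken to be the smallest entry of \<open>\<mu>\<close>.\<close>

locale transport_reference = transport_graph E w \<pi>
  for E :: "'v::finite set set" and w :: "'v \<Rightarrow> 'v \<Rightarrow> real" and \<pi> :: "real^'v" +
  fixes \<mu> :: "real^'v" and m :: real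
  assumes \<mu>: "\<mu> \<in> pos_prob_densities" and m_pos: "0 < m" and m_le: "\<And>x. m \<le> \<mu> $ x"
begin

section \<open>The limiting quadratic form\<close>

abbreviation H :: "real^'v \<Rightarrow> real" where
  "H h \<equiv> h \<bullet> (pinv (L \<mu>) *v h)"

lemma \<mu>_pos: "0 < \<mu> $ x"
  using \<mu> by (simp add: pos_prob_densities_def)

lemmas L\<mu> = edges edge_weights_reweight[OF \<mu>_pos]

lemma L_pinv: "h \<in> sum_zero_vectors \<Longrightarrow> L \<mu> *v (pinv (L \<mu>) *v h) = h"
  by (rule laplacian_pinv[OF L\<mu> connected])

lemma H_eq: "h \<in> sum_zero_vectors \<Longrightarrow> H h = (pinv (L \<mu>) *v h) \<bullet> (L \<mu> *v (pinv (L \<mu>) *v h))"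
  by (simp add: L_pinv inner_commute)

lemma H_nonneg: "h \<in> sum_zero_vectors \<Longrightarrow> 0 \<le> H h"
  using laplacian_form_nonneg[OF L\<mu>] by (simp only: H_eq)

text \<open>Cauchy-Schwarz and the operator norm. The bound is uniform in \<open>h\<close>, which
  keeps the constant of the lower bound independent of \<open>h\<close>.\<close>

lemma H_le:
  assumes "norm h \<le> 1"
  shows "H h \<le> onorm ((*v) (pinv (L \<mu>)))"
proof -
  have "H h \<le> norm h * norm (pinv (L \<mu>) *v h)"
    by (rule norm_cauchy_schwarz)
  also have "\<dots> \<le> 1 * (onorm ((*v) (pinv (L \<mu>))) * norm h)"
    using assms by (intro mult_mono onorm) auto
  also have "\<dots> \<le> onorm ((*v) (pinv (L \<mu>)))"
    using assms by (simp add: mult_left_le onorm_pos_le)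
  finally show ?thesis .
qed

lemma action_upper_bound:
  assumes h: "h \<in> sum_zero_vectors" "norm h \<le> 1" and \<epsilon>: "\<bar>\<epsilon>\<bar> < m"
  obtains \<rho> \<psi> where "admissible E w \<pi> \<mu> (\<mu> + \<epsilon> *\<^sub>R h) \<rho> \<psi>"
    "action E w \<pi> \<rho> \<psi> \<le> ennreal (\<epsilon>\<^sup>2 / (1 - 1 / m * \<bar>\<epsilon>\<bar>) * H h)"
proof -
  \<comment> \<open>Entries of \<open>h\<close> are at most 1 in absolute value, so the line moves
    each entry by at most \<bar>\<epsilon>\<bar>, which is at most the fraction
    \<open>\<bar>\<epsilon>\<bar> / m\<close> of \<open>\<mu> $ x\<close>.\<close>
  define d where "d = 1 - 1 / m * \<bar>\<epsilon>\<bar>"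
  have d: "0 < d" "d \<le> 1"
    using \<epsilon> m_pos by (auto simp: d_def)
  define \<rho> where "\<rho> t = \<mu> + (t * \<epsilon>) *\<^sub>R h" for t
  have lower: "d * \<mu> $ x \<le> \<rho> t $ x" if t: "t \<in> {0..1}" for t x
  proof -
    have "\<bar>t * \<epsilon> * h $ x\<bar> \<le> 1 * \<bar>\<epsilon>\<bar> * 1"
      unfolding abs_mult using t component_le_norm_cart[of h x] h(2) by (intro mult_mono) auto
    then have "- \<bar>\<epsilon>\<bar> \<le> t * \<epsilon> * h $ x"
      by linarith
    moreover have "1 * \<bar>\<epsilon>\<bar> \<le> \<mu> $ x / m * \<bar>\<epsilon>\<bar>"
      using m_le[of x] m_pos by (intro mult_right_mono) auto
    ultimately show ?thesis
      by (simp add: d_def \<rho>_def algebra_simps)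
  qed
  have \<rho>_pos: "0 < \<rho> t $ x" if "t \<in> {0..1}" for t x
    using lower[OF that, of x] mult_pos_pos[OF d(1) \<mu>_pos[of x]] by linarith
  have \<rho>: "\<rho> t \<in> pos_prob_densities" if "t \<in> {0..1}" for t
    using \<rho>_pos[OF that] h(1) \<mu>
    by (simp add: pos_prob_densities_def sum_zero_vectors_def \<rho>_def sum.distrib flip: sum_distrib_left)
  have \<epsilon>h: "\<epsilon> *\<^sub>R h \<in> sum_zero_vectors"
    using h(1) by (simp add: sum_zero_vectors_def flip: sum_distrib_left)
  \<comment> \<open>The matrices along the line depend continuously on time, so the potential can be
    chosen continuous and is therefore Borel measurable.\<close>
  have cont_mean: "continuous_on {0..1} (\<lambda>t. edge_mean \<pi> (\<rho> t) x y)" for x y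
    unfolding edge_mean_def using \<rho>_pos \<pi>_pos \<pi>_pos[THEN less_imp_neq]
    by (intro continuous_on_log_mean continuous_intros) (auto simp: \<rho>_def intro!: continuous_intros)
  have *: "continuous_on {0..1} (\<lambda>t. (L (\<rho> t) + mean_matrix) $ x $ y)" for x y
    unfolding laplacian_def degree_matrix_def adjacency_matrix_def degree_def reweight_def
    by (cases "x = y"; cases "{x, y} \<in> E") (auto intro!: continuous_intros cont_mean)
  have "continuous_on {0..1} (\<lambda>t. \<chi> x y. (L (\<rho> t) + mean_matrix) $ x $ y)"
    by (intro continuous_on_vec_lambda *)
  then have "continuous_on {0..1} (\<lambda>t. L (\<rho> t) + mean_matrix)"
    by (simp only: vec_lambda_eta)
  then obtain \<psi> where \<psi>: "continuous_on {0..1} \<psi>"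
      "\<And>t. t \<in> {0..1} \<Longrightarrow> (L (\<rho> t) + mean_matrix) *v \<psi> t = \<epsilon> *\<^sub>R h"
    by (rule continuous_on_linear_solve[where b = "\<epsilon> *\<^sub>R h"])
       (use laplacian_plus_mean_invertible[OF edges edge_weights_reweight connected] \<rho>_pos in auto)
  have L\<psi>: "L (\<rho> t) *v \<psi> t = \<epsilon> *\<^sub>R h" if "t \<in> {0..1}" for t
    using laplacian_plus_mean_solution[OF edges edge_weights_reweight \<epsilon>h \<psi>(2)] \<rho>_pos that by blast
  have energy: "dirichlet_energy E w \<pi> (\<rho> t) (\<psi> t) \<le> \<epsilon>\<^sup>2 / d * H h" if t: "t \<in> {0..1}" for t
  proof -
    let ?q = "\<psi> t \<bullet> (L (\<rho> t) *v \<psi> t)"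
    have q: "\<epsilon> * (\<psi> t \<bullet> h) = ?q"
      by (simp add: L\<psi>[OF t])
    have "\<psi> t \<bullet> (L \<mu> *v \<psi> t) \<le> 1 / d * ?q"
      using d lower[OF t] \<rho>_pos[OF t] by (intro L_form_scale) (auto simp: \<mu>_pos field_simps)
    then have "d * (d * (\<psi> t \<bullet> (L \<mu> *v \<psi> t))) \<le> d * ?q"
      using d by (simp add: field_simps)
    \<comment> \<open>Duality for \<open>L \<mu>\<close> between the potential of the line, scaled
      by \<open>d\<close>, and that of the limiting problem, scaled by \<epsilon>. With the factor
      \<open>d\<close> the form comparison absorbs the quadratic term into half of the linear
      one.\<close>
    moreover have "2 * (d * ?q) - d * (d * (\<psi> t \<bullet> (L \<mu> *v \<psi> t))) \<le> \<epsilon>\<^sup>2 * H h"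
      using laplacian_duality[OF L\<mu>, of "d *\<^sub>R \<psi> t" "\<epsilon> *\<^sub>R (pinv (L \<mu>) *v h)"]
      by (simp add: matrix_vector_mult_scaleR L_pinv[OF h(1)] q power2_eq_square inner_commute
          flip: q mult.assoc)
    ultimately have "d * ?q \<le> \<epsilon>\<^sup>2 * H h"
      by linarith
    then show ?thesis
      using d \<rho>_pos[OF t] by (simp add: dirichlet_energy_eq field_simps)
  qed
  show ?thesis
  proof
    have "(\<rho> has_vector_derivative \<epsilon> *\<^sub>R h) (at t within {0..1})" for t
      unfolding \<rho>_def by (auto intro!: derivative_eq_intros)
    then show "admissible E w \<pi> \<mu> (\<mu> + \<epsilon> *\<^sub>R h) \<rho> \<psi>"
      unfolding admissible_iff using \<rho> L\<psi> borel_measurable_continuous_on_restrict[OF \<psi>(1)]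
      by (auto simp: \<rho>_def intro!: exI[of _ "\<lambda>_. \<epsilon> *\<^sub>R h"])
    have "action E w \<pi> \<rho> \<psi> \<le> (\<integral>\<^sup>+ t\<in>{0..1::real}. ennreal (\<epsilon>\<^sup>2 / d * H h) \<partial>lborel)"
      unfolding action_def using energy
      by (intro nn_integral_mono) (auto simp: indicator_def intro!: ennreal_leI)
    then show "action E w \<pi> \<rho> \<psi> \<le> ennreal (\<epsilon>\<^sup>2 / (1 - 1 / m * \<bar>\<epsilon>\<bar>) * H h)"
      by (simp add: nn_integral_cmult_indicator d_def)
  qed
qed

lemma action_lower_bound:
  obtains C' where "0 < C'"
    "\<And>h \<epsilon> \<rho> \<psi>. h \<in> sum_zero_vectors \<Longrightarrow> norm h \<le> 1 \<Longrightarrow>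
      admissible E w \<pi> \<mu> (\<mu> + \<epsilon> *\<^sub>R h) \<rho> \<psi> \<Longrightarrow>
      ennreal (\<epsilon>\<^sup>2 / (1 + C' * \<bar>\<epsilon>\<bar>) * H h) \<le> action E w \<pi> \<rho> \<psi>"
proof -
  define p where "p = Min (range (($) \<pi>))"
  have p: "0 < p" "p \<le> \<pi> $ x" for x
    using \<pi>_pos by (auto simp: p_def)
  \<comment> \<open>Summing over all coordinate vectors gives one bound that serves every
    vertex.\<close>
  define B where "B = 1 / p * (\<Sum>x\<in>UNIV. axis x 1 \<bullet> (laplacian E w *v axis x 1))"
  define c where "c = onorm ((*v) (pinv (L \<mu>)))"
  \<comment> \<open>The a priori estimate below bounds displacements by
    \<open>\<bar>\<epsilon>\<bar> * (c + B) / 2\<close>; dividing by \<open>m\<close> makes this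
    relative to \<open>\<mu>\<close>, and the added 1 ensures positivity.\<close>
  define C' where "C' = (c + B) / (2 * m) + 1"
  have nonneg: "0 \<le> c" "0 \<le> B"
    using p(1) laplacian_form_nonneg[OF edges edge_weights]
    by (auto simp: c_def B_def onorm_pos_le sum_nonneg)
  then have C': "0 < C'"
    using m_pos by (simp add: C'_def add_nonneg_pos)
  show thesis
  proof (rule that[OF C'])
    fix h \<epsilon> \<rho> \<psi>
    assume h: "h \<in> sum_zero_vectors" "norm h \<le> 1"
      and adm: "admissible E w \<pi> \<mu> (\<mu> + \<epsilon> *\<^sub>R h) \<rho> \<psi>"
    define a where "a = 1 + C' * \<bar>\<epsilon>\<bar>"
    have a: "1 \<le> a" "0 < a"
      using C' by (auto simp: a_def intro: add_pos_nonneg)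
    have \<rho>: "\<rho> t \<in> pos_prob_densities" if "t \<in> {0..1}" for t
      using adm that unfolding admissible_def by blast
    have \<rho>1: "\<rho> 1 = \<mu> + \<epsilon> *\<^sub>R h"
      using adm unfolding admissible_def by blast
    show "ennreal (\<epsilon>\<^sup>2 / (1 + C' * \<bar>\<epsilon>\<bar>) * H h) \<le> action E w \<pi> \<rho> \<psi>"
    \<comment> \<open>A curve of action at least \<open>\<epsilon>\<^sup>2 * H h\<close> satisfies
      the claim since \<open>a\<close> is at least 1. Any other curve has small action, which
      confines it near \<open>\<mu>\<close>.\<close>
    proof (cases "ennreal (\<epsilon>\<^sup>2 * H h) \<le> action E w \<pi> \<rho> \<psi>")
      case True
      have "\<epsilon>\<^sup>2 / a * H h \<le> \<epsilon>\<^sup>2 / 1 * H h"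
        using a H_nonneg[OF h(1)] by (intro mult_right_mono divide_left_mono) auto
      then show ?thesis
        using True by (auto simp: a_def intro: order_trans[OF ennreal_leI])
    next
      case False
      then have \<epsilon>: "\<epsilon> \<noteq> 0"
        by auto
      have near: "\<rho> T $ x \<le> a * \<mu> $ x" if T: "T \<in> {0..1}" for T x
      proof -
        \<comment> \<open>With the factor \<bar>\<epsilon>\<bar> the quadratic term of the dual
          bound is of the order \<open>\<epsilon>\<^sup>2\<close> of the action, and cancelling one
          factor leaves a displacement of order \<bar>\<epsilon>\<bar>.\<close>
        let ?f = "\<bar>\<epsilon>\<bar> *\<^sub>R axis x 1 :: real^'v"
        have "?f \<bullet> (L (\<rho> t) *v ?f) \<le> \<epsilon>\<^sup>2 * B" if "t \<in> {0..T}" for t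
        proof -
          have "axis x 1 \<bullet> (L (\<rho> t) *v axis x 1) \<le> 1 / p * (axis x 1 \<bullet> (laplacian E w *v axis x 1))"
            using that T by (intro L_form_le \<rho> p) auto
          also have "\<dots> \<le> B"
            unfolding B_def using p laplacian_form_nonneg[OF edges edge_weights]
            by (intro mult_left_mono member_le_sum) auto
          finally show ?thesis
            by (simp add: matrix_vector_mult_scaleR power2_eq_square mult_left_mono flip: mult.assoc)
        qed
        then have "ennreal (2 * (?f \<bullet> (\<rho> T - \<mu>)) - \<epsilon>\<^sup>2 * B * T) \<le> action E w \<pi> \<rho> \<psi>"
          using T by (intro action_ge[OF adm]) auto
        then have "\<not> ennreal (\<epsilon>\<^sup>2 * H h) \<le> ennreal (2 * (?f \<bullet> (\<rho> T - \<mu>)) - \<epsilon>\<^sup>2 * B * T)"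
          using False order_trans by blast
        then have "2 * (?f \<bullet> (\<rho> T - \<mu>)) - \<epsilon>\<^sup>2 * B * T < \<epsilon>\<^sup>2 * H h"
          using ennreal_leI not_le by blast
        moreover have "\<epsilon>\<^sup>2 * B * T \<le> \<epsilon>\<^sup>2 * B" "\<epsilon>\<^sup>2 * H h \<le> \<epsilon>\<^sup>2 * c"
          using T nonneg H_le[OF h(2)] by (auto simp: c_def intro: mult_left_mono mult_left_le)
        ultimately have "\<bar>\<epsilon>\<bar> * (2 * (\<rho> T $ x - \<mu> $ x)) \<le> \<bar>\<epsilon>\<bar> * (\<bar>\<epsilon>\<bar> * (c + B))"
          by (simp add: inner_axis' power2_eq_square algebra_simps)
        then have "\<rho> T $ x - \<mu> $ x \<le> \<bar>\<epsilon>\<bar> * (c + B) / 2"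
          using \<epsilon> by simp
        also have "\<dots> = (C' - 1) * \<bar>\<epsilon>\<bar> * m"
          using m_pos by (simp add: C'_def field_simps)
        also have "\<dots> \<le> C' * \<bar>\<epsilon>\<bar> * \<mu> $ x"
          using C' m_le[of x] m_pos by (intro mult_mono) auto
        finally show ?thesis
          by (simp add: a_def algebra_simps)
      qed
      let ?\<phi> = "pinv (L \<mu>) *v h"
      \<comment> \<open>Among the multiples \<open>s\<close> of \<open>?\<phi>\<close>, the dual
        bound \<open>2 * s * \<epsilon> * H h - a * s\<^sup>2 * H h\<close> is largest at
        \<open>s = \<epsilon> / a\<close>.\<close>
      let ?f = "(\<epsilon> / a) *\<^sub>R ?\<phi>"
      have *: "?f \<bullet> (L (\<rho> t) *v ?f) \<le> a * (?f \<bullet> (L \<mu> *v ?f))" if "t \<in> {0..1}" for t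
        using near[OF that] a \<rho>[OF that] by (intro L_form_scale) (auto simp: \<mu>_pos pos_prob_densities_def)
      have "ennreal (2 * (?f \<bullet> (\<rho> 1 - \<mu>)) - a * (?f \<bullet> (L \<mu> *v ?f)) * 1) \<le> action E w \<pi> \<rho> \<psi>"
        by (intro action_ge[OF adm] *) auto
      also have "2 * (?f \<bullet> (\<rho> 1 - \<mu>)) - a * (?f \<bullet> (L \<mu> *v ?f)) * 1 = \<epsilon>\<^sup>2 / a * H h"
        using a by (simp add: \<rho>1 matrix_vector_mult_scaleR L_pinv[OF h(1)] inner_commute[of _ h]
            field_simps power2_eq_square)
      finally show ?thesis
        by (simp add: a_def)
    qed
  qed
qed

section \<open>From the action of curves to the distance\<close>

lemma transport_dist_upper:
  assumes h: "h \<in> sum_zero_vectors" "norm h \<le> 1" and \<epsilon>: "\<bar>\<epsilon>\<bar> < m"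
  shows "(transport_dist E w \<pi> \<mu> (\<mu> + \<epsilon> *\<^sub>R h))\<^sup>2 \<le> \<epsilon>\<^sup>2 / (1 - 1 / m * \<bar>\<epsilon>\<bar>) * H h"
proof -
  obtain \<rho> \<psi> where *: "admissible E w \<pi> \<mu> (\<mu> + \<epsilon> *\<^sub>R h) \<rho> \<psi>"
    "action E w \<pi> \<rho> \<psi> \<le> ennreal (\<epsilon>\<^sup>2 / (1 - 1 / m * \<bar>\<epsilon>\<bar>) * H h)"
    by (rule action_upper_bound[OF assms])
  have "0 \<le> \<epsilon>\<^sup>2 / (1 - 1 / m * \<bar>\<epsilon>\<bar>) * H h"
    using \<epsilon> m_pos H_nonneg[OF h(1)] by (intro mult_nonneg_nonneg divide_nonneg_nonneg) auto
  then show ?thesis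
    unfolding transport_dist_def real_sqrt_pow2[OF enn2real_nonneg]
    using * by (intro enn2real_leI INF_lower2[of "(\<rho>, \<psi>)"]) auto
qed

text \<open>\<open>enn2real\<close> sends infinity to 0, so a lower bound on all actions survives
  the conversion only if the infimum is finite. The curve from \<open>action_upper_bound\<close>
  ensures this, whence the condition on \<epsilon>.\<close>

lemma transport_dist_lower:
  assumes h: "h \<in> sum_zero_vectors" "norm h \<le> 1" and \<epsilon>: "\<bar>\<epsilon>\<bar> < m"
    and l: "0 \<le> l" "\<And>\<rho> \<psi>. admissible E w \<pi> \<mu> (\<mu> + \<epsilon> *\<^sub>R h) \<rho> \<psi> \<Longrightarrow> ennreal l \<le> action E w \<pi> \<rho> \<psi>"
  shows "l \<le> (transport_dist E w \<pi> \<mu> (\<mu> + \<epsilon> *\<^sub>R h))\<^sup>2"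
proof -
  let ?I = "INF (\<rho>, \<psi>) \<in> {(\<rho>, \<psi>). admissible E w \<pi> \<mu> (\<mu> + \<epsilon> *\<^sub>R h) \<rho> \<psi>}. action E w \<pi> \<rho> \<psi>"
  obtain \<rho> \<psi> where *: "admissible E w \<pi> \<mu> (\<mu> + \<epsilon> *\<^sub>R h) \<rho> \<psi>"
    "action E w \<pi> \<rho> \<psi> \<le> ennreal (\<epsilon>\<^sup>2 / (1 - 1 / m * \<bar>\<epsilon>\<bar>) * H h)"
    by (rule action_upper_bound[OF h \<epsilon>])
  then have "?I \<le> ennreal (\<epsilon>\<^sup>2 / (1 - 1 / m * \<bar>\<epsilon>\<bar>) * H h)"
    by (intro INF_lower2[of "(\<rho>, \<psi>)"]) auto
  then have "?I < top"
    using ennreal_less_top le_less_trans by blast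
  moreover have "ennreal l \<le> ?I"
    using l(2) by (intro INF_greatest) auto
  ultimately have "enn2real (ennreal l) \<le> enn2real ?I"
    by (intro enn2real_mono)
  then show ?thesis
    unfolding transport_dist_def real_sqrt_pow2[OF enn2real_nonneg] by (simp add: l(1))
qed

end

section \<open>From two-sided bounds to the asymptotic expansion\<close>

lemma smallo_square_at_0:
  fixes F :: "real \<Rightarrow> real"
  assumes "0 < \<epsilon>\<^sub>0" and F: "\<And>\<epsilon>. \<bar>\<epsilon>\<bar> < \<epsilon>\<^sub>0 \<Longrightarrow> \<bar>F \<epsilon>\<bar> \<le> K * \<bar>\<epsilon>\<bar> * \<epsilon>\<^sup>2"
  shows "F \<in> o[at 0](\<lambda>\<epsilon>. \<bar>\<epsilon>\<bar>\<^sup>2)"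
proof (rule landau_o.smallI)
  fix c :: real
  assume c: "0 < c"
  \<comment> \<open>The denominator \<open>\<bar>K\<bar> + 1\<close> is positive and dominates
    \<open>K\<close> whatever its sign, so \<open>K * \<bar>\<epsilon>\<bar>\<close> stays below
    \<open>c\<close>.\<close>
  define \<delta> where "\<delta> = min \<epsilon>\<^sub>0 (c / (\<bar>K\<bar> + 1))"
  have "0 < \<delta>"
    using c assms(1) by (simp add: \<delta>_def add_nonneg_pos)
  moreover have "norm (F \<epsilon>) \<le> c * norm (\<bar>\<epsilon>\<bar>\<^sup>2)" if "\<bar>\<epsilon>\<bar> < \<delta>" for \<epsilon>
  proof -
    have "K * \<bar>\<epsilon>\<bar> \<le> (\<bar>K\<bar> + 1) * (c / (\<bar>K\<bar> + 1))"
      using that by (intro mult_mono) (auto simp: \<delta>_def)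
    also have "\<dots> = c"
      by (simp add: add_nonneg_eq_0_iff)
    finally have "K * \<bar>\<epsilon>\<bar> * \<epsilon>\<^sup>2 \<le> c * \<epsilon>\<^sup>2"
      by (intro mult_right_mono) auto
    with F[of \<epsilon>] that show ?thesis
      by (simp add: \<delta>_def)
  qed
  ultimately show "\<forall>\<^sub>F \<epsilon> in at 0. norm (F \<epsilon>) \<le> c * norm (\<bar>\<epsilon>\<bar>\<^sup>2)"
    by (auto simp: eventually_at dist_real_def)
qed

text \<open>Linearise both factors: \<open>1 / (1 - s) \<le> 1 + 2 * s\<close> for \<open>s\<close>
  between 0 and 1/2, and \<open>1 / (1 + s) \<ge> 1 - s\<close> for nonnegative
  \<open>s\<close>.\<close>

lemma sandwich_linear_error:
  fixes M H C C' e :: real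
  assumes "0 \<le> H" "0 \<le> C" "0 \<le> C'" "0 \<le> e" "2 * (C * e) \<le> 1"
    and lower: "\<epsilon>\<^sup>2 / (1 + C' * e) * H \<le> M" and upper: "M \<le> \<epsilon>\<^sup>2 / (1 - C * e) * H"
  shows "\<bar>M - \<epsilon>\<^sup>2 * H\<bar> \<le> (2 * C + C') * H * e * \<epsilon>\<^sup>2"
proof -
  have nonneg: "0 \<le> C * e" "0 \<le> C' * e" "0 \<le> \<epsilon>\<^sup>2 * H"
    using assms by simp_all
  have "1 \<le> (1 + 2 * (C * e)) * (1 - C * e)"
    using mult_left_mono[OF assms(5) nonneg(1)] by (simp add: algebra_simps)
  then have "1 / (1 - C * e) \<le> 1 + 2 * (C * e)"
    using assms by (subst pos_divide_le_eq) auto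
  from mult_left_mono[OF this nonneg(3)]
  have 1: "M \<le> \<epsilon>\<^sup>2 * H + 2 * C * H * e * \<epsilon>\<^sup>2"
    using upper by (simp add: algebra_simps)
  have "(1 - C' * e) * (1 + C' * e) \<le> 1"
    using zero_le_square[of "C' * e"] by (simp add: algebra_simps)
  then have "1 - C' * e \<le> 1 / (1 + C' * e)"
    using nonneg by (subst pos_le_divide_eq) auto
  from mult_left_mono[OF this nonneg(3)]
  have 2: "\<epsilon>\<^sup>2 * H - C' * H * e * \<epsilon>\<^sup>2 \<le> M"
    using lower by (simp add: algebra_simps)
  have "0 \<le> C * e * (\<epsilon>\<^sup>2 * H)" "0 \<le> C' * e * (\<epsilon>\<^sup>2 * H)"
    using nonneg by simp_all
  with 1 2 show ?thesis
    by (simp add: abs_le_iff algebra_simps)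
qed

theorem theorem1p2:
  fixes E :: "'v::finite set set" and w :: "'v \<Rightarrow> 'v \<Rightarrow> real"
    and \<pi> \<mu> :: "real^'v"
  assumes "weighted_graph E w"
    and "connected_graph E"
    and "stationary_distribution E w \<pi>"
    and "\<mu> \<in> pos_prob_densities"
  shows "\<exists>C>0. \<exists>C'>0. \<exists>\<epsilon>\<^sub>0>0. \<forall>h :: real^'v. h \<in> sum_zero_vectors \<and> norm h \<le> 1 \<longrightarrow>
    (\<forall>\<epsilon>::real. \<bar>\<epsilon>\<bar> < \<epsilon>\<^sub>0 \<longrightarrow>
      \<epsilon>\<^sup>2 / (1 + C' * \<bar>\<epsilon>\<bar>) * (h \<bullet> (pinv (laplacian E (reweight w \<pi> \<mu>)) *v h))
        \<le> (transport_dist E w \<pi> \<mu> (\<mu> + \<epsilon> *\<^sub>R h))\<^sup>2 \<and>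
      (transport_dist E w \<pi> \<mu> (\<mu> + \<epsilon> *\<^sub>R h))\<^sup>2
        \<le> \<epsilon>\<^sup>2 / (1 - C * \<bar>\<epsilon>\<bar>) * (h \<bullet> (pinv (laplacian E (reweight w \<pi> \<mu>)) *v h))) \<and>
    (\<lambda>\<epsilon>::real. (transport_dist E w \<pi> \<mu> (\<mu> + \<epsilon> *\<^sub>R h))\<^sup>2
        - \<bar>\<epsilon>\<bar>\<^sup>2 * (h \<bullet> (pinv (laplacian E (reweight w \<pi> \<mu>)) *v h)))
      \<in> o[at 0](\<lambda>\<epsilon>. \<bar>\<epsilon>\<bar>\<^sup>2)"
proof -
  define m where "m = Min (range (($) \<mu>))"
  have m: "0 < m" "m \<le> \<mu> $ x" for x
    using assms(4) by (auto simp: m_def pos_prob_densities_def)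
  interpret transport_reference E w \<pi> \<mu> m
    using assms m stationary_distribution_pos[OF assms(1-3)] by unfold_locales
  obtain C' where C': "0 < C'" and lower: "\<And>h \<epsilon> \<rho> \<psi>. h \<in> sum_zero_vectors \<Longrightarrow> norm h \<le> 1 \<Longrightarrow>
      admissible E w \<pi> \<mu> (\<mu> + \<epsilon> *\<^sub>R h) \<rho> \<psi> \<Longrightarrow>
      ennreal (\<epsilon>\<^sup>2 / (1 + C' * \<bar>\<epsilon>\<bar>) * H h) \<le> action E w \<pi> \<rho> \<psi>"
    by (rule action_lower_bound) blast
  \<comment> \<open>The upper bound degenerates at \<open>\<bar>\<epsilon>\<bar> = m\<close>; half
    of that radius keeps its denominator above 1/2, as the linearisation requires.\<close>
  let ?C = "1 / m" and ?\<epsilon>\<^sub>0 = "m / 2"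
  let ?D = "\<lambda>h \<epsilon>. (transport_dist E w \<pi> \<mu> (\<mu> + \<epsilon> *\<^sub>R h))\<^sup>2"
  have bounds: "\<epsilon>\<^sup>2 / (1 + C' * \<bar>\<epsilon>\<bar>) * H h \<le> ?D h \<epsilon>" "?D h \<epsilon> \<le> \<epsilon>\<^sup>2 / (1 - ?C * \<bar>\<epsilon>\<bar>) * H h"
    if h: "h \<in> sum_zero_vectors" "norm h \<le> 1" and \<epsilon>: "\<bar>\<epsilon>\<bar> < ?\<epsilon>\<^sub>0" for h \<epsilon>
  proof -
    have \<epsilon>m: "\<bar>\<epsilon>\<bar> < m"
      using \<epsilon> m(1) by linarith
    have "0 \<le> \<epsilon>\<^sup>2 / (1 + C' * \<bar>\<epsilon>\<bar>) * H h"
      using C' H_nonneg[OF h(1)] by simp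
    then show "\<epsilon>\<^sup>2 / (1 + C' * \<bar>\<epsilon>\<bar>) * H h \<le> ?D h \<epsilon>"
      using lower[OF h] by (rule transport_dist_lower[OF h \<epsilon>m])
    show "?D h \<epsilon> \<le> \<epsilon>\<^sup>2 / (1 - ?C * \<bar>\<epsilon>\<bar>) * H h"
      by (rule transport_dist_upper[OF h \<epsilon>m])
  qed
  have small: "(\<lambda>\<epsilon>. ?D h \<epsilon> - \<bar>\<epsilon>\<bar>\<^sup>2 * H h) \<in> o[at 0](\<lambda>\<epsilon>. \<bar>\<epsilon>\<bar>\<^sup>2)"
    if h: "h \<in> sum_zero_vectors" "norm h \<le> 1" for h
  proof (rule smallo_square_at_0)
    show "0 < ?\<epsilon>\<^sub>0"
      using m(1) by simp
    fix \<epsilon> :: real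
    assume \<epsilon>: "\<bar>\<epsilon>\<bar> < ?\<epsilon>\<^sub>0"
    then have "2 * (?C * \<bar>\<epsilon>\<bar>) \<le> 1"
      using m(1) by (simp add: field_simps)
    from sandwich_linear_error[OF H_nonneg[OF h(1)] _ _ _ this bounds[OF h \<epsilon>]]
    show "\<bar>?D h \<epsilon> - \<bar>\<epsilon>\<bar>\<^sup>2 * H h\<bar> \<le> (2 * ?C + C') * H h * \<bar>\<epsilon>\<bar> * \<epsilon>\<^sup>2"
      using C' m(1) by simp
  qed
  have "0 < ?C" "0 < ?\<epsilon>\<^sub>0"
    using m(1) by simp_all
  with C' bounds small show ?thesis
    by blast
qed

end
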